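(* Semi-Eberlein compact spaces do not have P-points; that is, if $K$ is a semi-Eberlein compact space, then no point of $K$ is a P-point of $K$.
   Context: For a set $S$, $c_0(S)$ is the set of all $x\in\mathbb{R}^S$ such that for every $\varepsilon>0$ the set $\{s\in S : |x(s)|>\varepsilon\}$ is finite; $\mathbb{R}^S$ carries the product topology. A compact (Hausdorff) space $K$ is semi-Eberlein if for some set $S$ there is a topological embedding of $K$ into $\mathbb{R}^S$ such that, identifying $K$ with its image, $c_0(S)\cap K$ is dense in $K$. A point $p$ of a space $X$ is a P-point if $p$ is not isolated and $p\in\operatorname{int}\bigcap_{n\in\omega}U_n$ for every sequence $\{U_n : n\in\omega\}$ of neighborhoods of $p$. *)

theory Defs
  imports "HOL-Analysis.Analysis"
begin

text \<open>As for \<^const>\<open>product_topology\<close>, elements of \<open>\<real>\<^sup>S\<close> are the functions on the ambient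
  index type that are \<^const>\<open>undefined\<close> outside \<open>S\<close>.\<close>

definition c0 :: "'s set \<Rightarrow> ('s \<Rightarrow> real) set" where
  "c0 S = {x \<in> S \<rightarrow>\<^sub>E UNIV. \<forall>\<epsilon>>0. finite {s \<in> S. \<bar>x s\<bar> > \<epsilon>}}"

text \<open>The index set \<open>S\<close> ranges over all sets whose elements come from the type \<open>'s\<close>. HOL cannot
  quantify over types inside a formula, so \<open>'s\<close> is an explicit parameter; a result assuming
  \<open>semi_Eberlein TYPE('s) K\<close> for an arbitrary \<open>'s\<close> covers index sets of every size.\<close>

definition semi_Eberlein :: "'s itself \<Rightarrow> 'a topology \<Rightarrow> bool" where
  "semi_Eberlein _ K \<longleftrightarrow>
     compact_space K \<and> Hausdorff_space K \<and>
     (\<exists>(S :: 's set) f.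
        embedding_map K (product_topology (\<lambda>_. euclideanreal) S) f \<and>
        subtopology (product_topology (\<lambda>_. euclideanreal) S) (f ` topspace K)
          closure_of (c0 S \<inter> f ` topspace K) = f ` topspace K)"

text \<open>Neighborhoods need not be open.\<close>

definition nbhd_of :: "'a topology \<Rightarrow> 'a \<Rightarrow> 'a set \<Rightarrow> bool" where
  "nbhd_of X p U \<longleftrightarrow> U \<subseteq> topspace X \<and> p \<in> X interior_of U"

definition P_point :: "'a topology \<Rightarrow> 'a \<Rightarrow> bool" where
  "P_point X p \<longleftrightarrow>
     p \<in> topspace X \<and> \<not> openin X {p} \<and>
     (\<forall>U :: nat \<Rightarrow> 'a set. (\<forall>n. nbhd_of X p (U n)) \<longrightarrow> p \<in> X interior_of (\<Inter>n. U n))"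

end

theory Submission imports Defs begin

text \<open>Let \<open>p\<close> be a P-point of \<open>K \<subseteq> \<real>\<^sup>S\<close>. For countable \<open>A \<subseteq> S\<close> the points that agree with \<open>p\<close>
  on \<open>A\<close> form a neighborhood of \<open>p\<close>, which therefore meets \<open>c\<^sub>0(S)\<close>. This forces \<open>p \<in> c\<^sub>0(S)\<close>:
  otherwise take \<open>A\<close> to be an infinite countable set on which \<open>\<bar>p\<bar> > \<epsilon>\<close>. Hence \<open>p\<close> has countable
  support, and one can choose recursively \<open>x\<^sub>n \<in> c\<^sub>0(S) \<inter> K\<close>, \<open>x\<^sub>n \<noteq> p\<close>, agreeing with \<open>p\<close> on the
  supports of \<open>p, x\<^sub>0, \<dots>, x\<^sub>n\<^sub>-\<^sub>1\<close>. The differences \<open>x\<^sub>n - p\<close> have disjoint supports, so \<open>x\<^sub>n\<close>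
  converges to \<open>p\<close>; but no sequence in \<open>K - {p}\<close> converges to a P-point.\<close>

text \<open>Form of the P-point property used below: open sets and an arbitrary countable index set,
  enumerated by \<open>from_nat_into\<close>. That enumeration needs \<open>I\<close> nonempty,
  hence the case split.\<close>

lemma P_point_countable_Inter:
  assumes p: "P_point X p" and "countable I"
    and U: "\<And>i. i \<in> I \<Longrightarrow> openin X (U i)" "\<And>i. i \<in> I \<Longrightarrow> p \<in> U i"
  obtains V where "openin X V" "p \<in> V" "\<And>i. i \<in> I \<Longrightarrow> V \<subseteq> U i"
proof (cases "I = {}")
  case True
  with p show ?thesis
    by (intro that[of "topspace X"]) (auto simp: P_point_def)
next
  case False
  define W where "W n = U (from_nat_into I n)" for n
  have "nbhd_of X p (W n)" for n
    using U from_nat_into[OF False, of n]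
    by (simp add: nbhd_of_def W_def interior_of_openin openin_subset)
  with p have W: "p \<in> X interior_of (\<Inter>n. W n)"
    unfolding P_point_def by blast
  have "X interior_of (\<Inter>n. W n) \<subseteq> U i" if i: "i \<in> I" for i
  proof -
    obtain n where "from_nat_into I n = i"
      using from_nat_into_surj[OF \<open>countable I\<close> i] by blast
    then have "(\<Inter>n. W n) \<subseteq> U i"
      by (auto simp: W_def)
    then show ?thesis
      using interior_of_subset by (rule subset_trans[rotated])
  qed
  with W show ?thesis
    by (intro that[of "X interior_of (\<Inter>n. W n)"]) simp_all
qed

text \<open>The preimages of the balls of radius \<open>1 / Suc n\<close> about \<open>f p s\<close>
  are countably many open neighborhoods of \<open>p\<close>; lying in all of them forces equality on
  \<open>A\<close>.\<close>

lemma P_point_eq_on_countable: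
  fixes f :: "'a \<Rightarrow> 's \<Rightarrow> real"
  assumes p: "P_point X p" and "countable A"
    and cont: "\<And>s. s \<in> A \<Longrightarrow> continuous_map X euclideanreal (\<lambda>x. f x s)"
  obtains V where "openin X V" "p \<in> V" "\<And>x s. x \<in> V \<Longrightarrow> s \<in> A \<Longrightarrow> f x s = f p s"
proof -
  define B where "B s n = {x \<in> topspace X. f x s \<in> ball (f p s) (1 / Suc n)}" for s and n :: nat
  have B: "openin X (B s n)" "p \<in> B s n" if "s \<in> A" for s n
    using openin_continuous_map_preimage[OF cont[OF that], of "ball (f p s) (1 / Suc n)"] p
    by (auto simp: B_def P_point_def)
  have "countable (A \<times> (UNIV :: nat set))"
    using \<open>countable A\<close> by simp
  then obtain V where V: "openin X V" "p \<in> V"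
      "\<And>i. i \<in> A \<times> UNIV \<Longrightarrow> V \<subseteq> (case i of (s, n) \<Rightarrow> B s n)"
    by (rule P_point_countable_Inter[OF p, where U = "\<lambda>(s, n). B s n"]) (auto simp: B)
  have "f x s = f p s" if "x \<in> V" "s \<in> A" for x s
  proof (rule ccontr)
    assume "f x s \<noteq> f p s"
    then obtain n where "1 / Suc n < dist (f p s) (f x s)"
      by (metis dist_pos_lt inverse_eq_divide reals_Archimedean)
    moreover have "x \<in> B s n"
      using V(3)[of "(s, n)"] that by auto
    ultimately show False
      by (auto simp: B_def)
  qed
  with V show ?thesis
    using that by blast
qed

text \<open>The complements of the points \<open>x n\<close> are countably many open neighborhoods
  of \<open>p\<close>, so some neighborhood misses the whole sequence.\<close>

lemma P_point_not_limit:
  assumes p: "P_point X p" and "Hausdorff_space X"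
    and x: "\<And>n :: nat. x n \<in> topspace X - {p}"
  shows "\<not> limitin X x p sequentially"
proof
  assume lim: "limitin X x p sequentially"
  have "openin X (topspace X - {x n})" "p \<in> topspace X - {x n}" for n
    using x[of n] p \<open>Hausdorff_space X\<close>
    by (auto simp: P_point_def closedin_Hausdorff_singleton)
  then obtain V where V: "openin X V" "p \<in> V" "\<And>n. V \<subseteq> topspace X - {x n}"
    using P_point_countable_Inter[OF p, of UNIV "\<lambda>n. topspace X - {x n}"] by auto
  then have "\<forall>\<^sub>F n in sequentially. x n \<in> V"
    using lim by (auto simp: limitin_def)
  then obtain n where "x n \<in> V"
    by (auto simp: eventually_sequentially)
  then show False
    using V(3)[of n] by blast
qed

text \<open>Allows convergence in \<open>K\<close> to be checked coordinatewise in the product, via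
  the continuous inverse on the image.\<close>

lemma embedding_map_limitin:
  assumes "embedding_map X Y f" "limitin Y (f \<circ> x) (f l) F"
    and "l \<in> topspace X" "\<And>n. x n \<in> topspace X"
  shows "limitin X x l F"
proof -
  obtain g where g: "homeomorphic_maps X (subtopology Y (f ` topspace X)) f g"
    using assms(1) by (auto simp: embedding_map_def homeomorphic_map_maps)
  then have "limitin X (g \<circ> (f \<circ> x)) (g (f l)) F"
    using assms by (intro continuous_map_limit[where X = "subtopology Y (f ` topspace X)"])
      (auto simp: homeomorphic_maps_def limitin_subtopology)
  moreover have "g \<circ> (f \<circ> x) = x" "g (f l) = l"
    using g assms by (auto simp: homeomorphic_maps_def)
  ultimately show ?thesis
    by simp
qed

lemma countable_support_c0:
  assumes "x \<in> c0 S"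
  shows "countable {s \<in> S. x s \<noteq> 0}"
proof -
  have "{s \<in> S. x s \<noteq> 0} \<subseteq> (\<Union>n :: nat. {s \<in> S. \<bar>x s\<bar> > 1 / Suc n})"
    by auto (metis inverse_eq_divide of_nat_Suc reals_Archimedean zero_less_abs_iff)
  moreover have "finite {s \<in> S. \<bar>x s\<bar> > 1 / Suc n}" for n :: nat
    using assms by (simp add: c0_def)
  then have "countable (\<Union>n :: nat. {s \<in> S. \<bar>x s\<bar> > 1 / Suc n})"
    by (intro countable_UN[OF countableI_type] countable_finite)
  ultimately show ?thesis
    by (rule countable_subset)
qed

lemma semi_Eberlein_dense:
  fixes K :: "'a topology"
  assumes "semi_Eberlein TYPE('s) K"
  obtains S :: "'s set" and f where
    "embedding_map K (product_topology (\<lambda>_. euclideanreal) S) f"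
    "\<And>W. openin K W \<Longrightarrow> W \<noteq> {} \<Longrightarrow> \<exists>x\<in>W. f x \<in> c0 S"
proof -
  obtain S :: "'s set" and f where
    emb: "embedding_map K (product_topology (\<lambda>_. euclideanreal) S) f" and
    dense: "subtopology (product_topology (\<lambda>_. euclideanreal) S) (f ` topspace K)
          closure_of (c0 S \<inter> f ` topspace K) = f ` topspace K"
    using assms unfolding semi_Eberlein_def by blast
  let ?Y = "subtopology (product_topology (\<lambda>_. euclideanreal) S) (f ` topspace K)"
  have "\<exists>x\<in>W. f x \<in> c0 S" if W: "openin K W" "W \<noteq> {}" for W
  proof -
    have "openin ?Y (f ` W)"
      using emb W(1) homeomorphic_imp_open_map
      by (auto simp: embedding_map_def open_map_def)
    moreover obtain w where "w \<in> W"
      using W(2) by blast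
    moreover have "f w \<in> ?Y closure_of (c0 S \<inter> f ` topspace K)"
      using \<open>w \<in> W\<close> openin_subset[OF W(1)] unfolding dense by blast
    ultimately obtain y where "y \<in> c0 S" "y \<in> f ` W"
      unfolding in_closure_of by blast
    then show ?thesis
      by blast
  qed
  with emb show ?thesis
    by (rule that)
qed

theorem theorem5p2:
  fixes K :: "'a topology"
  assumes "semi_Eberlein TYPE('s) K"
  shows "\<forall>p \<in> topspace K. \<not> P_point K p"
proof (intro ballI notI)
  fix p assume pK: "p \<in> topspace K" and p: "P_point K p"
  have K: "Hausdorff_space K"
    using assms by (simp add: semi_Eberlein_def)
  obtain S :: "'s set" and f where
    emb: "embedding_map K (product_topology (\<lambda>_. euclideanreal) S) f" and
    dense: "\<And>W. openin K W \<Longrightarrow> W \<noteq> {} \<Longrightarrow> \<exists>x\<in>W. f x \<in> c0 S"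
    using semi_Eberlein_dense[OF assms] by blast
  have f: "continuous_map K (product_topology (\<lambda>_. euclideanreal) S) f"
    using emb homeomorphic_imp_continuous_map
    by (fastforce simp: embedding_map_def continuous_map_in_subtopology)
  then have cont: "continuous_map K euclideanreal (\<lambda>x. f x s)" if "s \<in> S" for s
    using that by (simp add: continuous_map_componentwise)
  \<comment> \<open>Both \<open>c0 S\<close> and limits in the product require functions to be
    \<open>undefined\<close> outside \<open>S\<close>.\<close>
  have ext: "f x \<in> S \<rightarrow>\<^sub>E UNIV" if "x \<in> topspace K" for x
    using continuous_map_image_subset_topspace[OF f] that by (auto simp: PiE_def)

  have p_c0: "f p \<in> c0 S"
  proof (rule ccontr)
    assume "f p \<notin> c0 S"
    with ext[OF pK] obtain \<epsilon> where "\<epsilon> > 0" "infinite {s \<in> S. \<bar>f p s\<bar> > \<epsilon>}"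
      by (auto simp: c0_def)
    then obtain A where A: "A \<subseteq> {s \<in> S. \<bar>f p s\<bar> > \<epsilon>}" "infinite A" "countable A"
      by (meson infinite_countable_subset')
    obtain V where V: "openin K V" "p \<in> V" "\<And>x s. x \<in> V \<Longrightarrow> s \<in> A \<Longrightarrow> f x s = f p s"
      using P_point_eq_on_countable[where f = f, OF p A(3)] cont A(1) by blast
    obtain x where x: "x \<in> V" "f x \<in> c0 S"
      using dense[OF V(1)] V(2) by blast
    have "A \<subseteq> {s \<in> S. \<bar>f x s\<bar> > \<epsilon>}"
      using A(1) V(3)[OF x(1)] by auto
    then show False
      using A(2) x(2) \<open>\<epsilon> > 0\<close> by (auto simp: c0_def dest: finite_subset)
  qed

  define supp where "supp x = {s \<in> S. f x s \<noteq> 0}" for x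
  have "\<exists>x. x \<in> topspace K - {p} \<and> f x \<in> c0 S \<and> (\<forall>s\<in>A. f x s = f p s)"
    if A: "countable A" "A \<subseteq> S" for A
  proof -
    obtain V where V: "openin K V" "p \<in> V" "\<And>x s. x \<in> V \<Longrightarrow> s \<in> A \<Longrightarrow> f x s = f p s"
      using P_point_eq_on_countable[where f = f, OF p A(1)] cont A(2) by blast
    have "openin K (V - {p})"
      using V(1) K pK by (intro openin_diff) (simp_all add: closedin_Hausdorff_singleton)
    \<comment> \<open>Otherwise \<open>V = {p}\<close> would be open, but a P-point is not
      isolated.\<close>
    moreover have "V - {p} \<noteq> {}"
      using p V(1,2) unfolding P_point_def by (metis Diff_eq_empty_iff insert_absorb
          insert_subset singleton_insert_inj_eq subset_singletonD)
    ultimately obtain x where "x \<in> V - {p}" "f x \<in> c0 S"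
      using dense by blast
    then show ?thesis
      using V(3) openin_subset[OF V(1)] by blast
  qed
  then obtain g where g: "\<And>A. countable A \<Longrightarrow> A \<subseteq> S \<Longrightarrow>
      g A \<in> topspace K - {p} \<and> f (g A) \<in> c0 S \<and> (\<forall>s\<in>A. f (g A) s = f p s)"
    by metis
  \<comment> \<open>The recursion runs on the sets: \<open>A n\<close> collects the supports of
    \<open>p\<close> and of the points \<open>g (A m)\<close> with \<open>m < n\<close>.\<close>
  define A where "A = rec_nat (supp p) (\<lambda>_ B. B \<union> supp (g B))"
  have A_0: "A 0 = supp p" and A_Suc: "\<And>n. A (Suc n) = A n \<union> supp (g (A n))"
    by (simp_all add: A_def)
  have A: "countable (A n) \<and> A n \<subseteq> S" for n
  proof (induction n)
    case 0
    then show ?case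
      using countable_support_c0[OF p_c0] by (auto simp: A_0 supp_def)
  next
    case (Suc n)
    then show ?case
      using g[of "A n"] countable_support_c0[of "f (g (A n))" S] by (auto simp: A_Suc supp_def)
  qed
  define x where "x n = g (A n)" for n
  have x: "x n \<in> topspace K - {p}" and x_eq: "\<And>s. s \<in> A n \<Longrightarrow> f (x n) s = f p s" for n
    using g A[of n] by (auto simp: x_def)
  have A_mono: "A m \<subseteq> A n" if "m \<le> n" for m n
    using that by (rule lift_Suc_mono_le[rotated]) (auto simp: A_Suc)
  \<comment> \<open>At most one \<open>x m\<close> differs from \<open>p\<close> at
    \<open>s\<close>: there one of the two values is nonzero, so \<open>s\<close> enters
    \<open>A (Suc m)\<close>, where all later points agree with \<open>p\<close>.\<close>
  have "\<forall>\<^sub>F n in sequentially. f (x n) s = f p s" if "s \<in> S" for s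
  proof (cases "\<exists>m. f (x m) s \<noteq> f p s")
    case True
    then obtain m where "f (x m) s \<noteq> f p s" ..
    then have "s \<in> supp p \<or> s \<in> supp (g (A m))"
      using \<open>s \<in> S\<close> by (auto simp: supp_def x_def)
    then have "s \<in> A (Suc m)"
      using A_mono[of 0 "Suc m"] by (auto simp: A_0 A_Suc)
    then show ?thesis
      using A_mono x_eq unfolding eventually_sequentially by blast
  qed auto
  then have "limitin (product_topology (\<lambda>_. euclideanreal) S) (f \<circ> x) (f p) sequentially"
    using ext pK x by (auto simp: limitin_componentwise PiE_def intro!: tendsto_eventually)
  then have "limitin K x p sequentially"
    using embedding_map_limitin[OF emb] pK x by blast
  then show False
    using P_point_not_limit[where x = x, OF p K x] by blast
qed

end
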